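(* Let $G=A\rtimes K$ be a finite semidirect product with $A$ abelian. Then \[ m(G)=\max_{B\le K\ \text{abelian}} |\mathrm{C}_A(B)|\,|B|. \] Consequently, \[ \lambda_{\mathrm{prob}}(G)=\frac{1}{|A||K|}\max_{B\le K\ \text{abelian}} |\mathrm{C}_A(B)|\,|B|, \qquad \lambda_{\mathrm{orb}}(G)=\max_{B\le K\ \text{abelian}} |\mathrm{C}_A(B)|\,|B|, \] and equivalently \[ h_{\mathrm{prob}}(G)=\log\frac{|A||K|}{\max_{B\le K\ \text{abelian}} |\mathrm{C}_A(B)|\,|B|}, \qquad h_{\mathrm{orb}}(G)=\log\Bigl(\max_{B\le K\ \text{abelian}} |\mathrm{C}_A(B)|\,|B|\Bigr). \]
   Context: $A$ is the normal factor of $A\rtimes K$, and for $B\le K$, $\mathrm{C}_A(B)$ is the subgroup of elements of $A$ fixed by every element of $B$ under the action of $K$ on $A$. $m(G)$ is the maximum order of an abelian subgroup of $G$. For a finite group $G$ and $r\ge1$, $\mathrm{Hom}(\mathbb Z^r,G)$ is the set of pairwise commuting $r$-tuples in $G^r$, $P_r(G):=|\mathrm{Hom}(\mathbb Z^r,G)|/|G|^r$, and $\kappa_r(G)$ is the number of orbits of $G$ on $\mathrm{Hom}(\mathbb Z^r,G)$ under diagonal conjugation. Further, $\lambda_{\mathrm{prob}}(G):=\lim_{r\to\infty}P_r(G)^{1/r}$, $\lambda_{\mathrm{orb}}(G):=\lim_{r\to\infty}\kappa_r(G)^{1/r}$ (these limits exist for every finite group), $h_{\mathrm{prob}}(G):=-\log\lambda_{\mathrm{prob}}(G)$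 and $h_{\mathrm{orb}}(G):=\log\lambda_{\mathrm{orb}}(G)$. *)

theory Defs
  imports Complex_Main "HOL-Algebra.Bij" "HOL-Algebra.Group_Action" "HOL-Algebra.Generated_Groups"
begin

definition semidirect_product ::
    "('a, 'm) monoid_scheme \<Rightarrow> ('k, 'n) monoid_scheme \<Rightarrow> ('k \<Rightarrow> 'a \<Rightarrow> 'a) \<Rightarrow> ('a \<times> 'k) monoid"
  where "semidirect_product A K \<phi> =
    \<lparr>carrier = carrier A \<times> carrier K,
     mult = (\<lambda>(a, k) (b, l). (a \<otimes>\<^bsub>A\<^esub> \<phi> k b, k \<otimes>\<^bsub>K\<^esub> l)),
     one = (\<one>\<^bsub>A\<^esub>, \<one>\<^bsub>K\<^esub>)\<rparr>"

definition fixed_by :: "('a, 'm) monoid_scheme \<Rightarrow> ('k \<Rightarrow> 'a \<Rightarrow> 'a) \<Rightarrow> 'k set \<Rightarrow> 'a set"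
  where "fixed_by A \<phi> B = {a \<in> carrier A. \<forall>b\<in>B. \<phi> b a = a}"

definition abelian_subgroups :: "('a, 'm) monoid_scheme \<Rightarrow> 'a set set"
  where "abelian_subgroups G = {H. subgroup H G \<and> comm_group (G\<lparr>carrier := H\<rparr>)}"

definition max_abelian_order :: "('a, 'm) monoid_scheme \<Rightarrow> nat"
  where "max_abelian_order G = Max (card ` abelian_subgroups G)"

definition commuting_tuples :: "('a, 'm) monoid_scheme \<Rightarrow> nat \<Rightarrow> 'a list set"
  where "commuting_tuples G r =
    {xs. length xs = r \<and> set xs \<subseteq> carrier G \<and>
         (\<forall>x\<in>set xs. \<forall>y\<in>set xs. x \<otimes>\<^bsub>G\<^esub> y = y \<otimes>\<^bsub>G\<^esub> x)}"

definition commuting_prob :: "('a, 'm) monoid_scheme \<Rightarrow> nat \<Rightarrow> real"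
  where "commuting_prob G r = real (card (commuting_tuples G r)) / real (order G) ^ r"

definition diag_conj :: "('a, 'm) monoid_scheme \<Rightarrow> 'a \<Rightarrow> 'a list \<Rightarrow> 'a list"
  where "diag_conj G g xs = map (\<lambda>x. g \<otimes>\<^bsub>G\<^esub> x \<otimes>\<^bsub>G\<^esub> inv\<^bsub>G\<^esub> g) xs"

definition commuting_orbits :: "('a, 'm) monoid_scheme \<Rightarrow> nat \<Rightarrow> nat"
  where "commuting_orbits G r = card (orbits G (commuting_tuples G r) (diag_conj G))"

definition lambda_prob :: "('a, 'm) monoid_scheme \<Rightarrow> real"
  where "lambda_prob G = lim (\<lambda>r. root r (commuting_prob G r))"

definition lambda_orb :: "('a, 'm) monoid_scheme \<Rightarrow> real"
  where "lambda_orb G = lim (\<lambda>r. root r (real (commuting_orbits G r)))"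

definition h_prob :: "('a, 'm) monoid_scheme \<Rightarrow> real"
  where "h_prob G = - ln (lambda_prob G)"

definition h_orb :: "('a, 'm) monoid_scheme \<Rightarrow> real"
  where "h_orb G = ln (lambda_orb G)"

lemma group_semidirect_product:
  assumes "group A" and "group K" and phi: "\<phi> \<in> hom K (AutoGroup A)"
  shows "group (semidirect_product A K \<phi>)"
proof -
  interpret A: group A by fact
  interpret K: group K by fact
  have aut: "\<phi> k \<in> auto A" if "k \<in> carrier K" for k
    using phi that by (auto simp: hom_def AutoGroup_def)
  have cl: "\<phi> k a \<in> carrier A" if "k \<in> carrier K" "a \<in> carrier A" for k a
    using aut[OF that(1)] that(2) by (auto simp: auto_def hom_def)
  have mul: "\<phi> k (a \<otimes>\<^bsub>A\<^esub> b) = \<phi> k a \<otimes>\<^bsub>A\<^esub> \<phi> k b"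
    if "k \<in> carrier K" "a \<in> carrier A" "b \<in> carrier A" for k a b
    using aut[OF that(1)] that(2,3) by (auto simp: auto_def hom_def)
  have act: "\<phi> (k \<otimes>\<^bsub>K\<^esub> l) a = \<phi> k (\<phi> l a)"
    if "k \<in> carrier K" "l \<in> carrier K" "a \<in> carrier A" for k l a
    using phi aut[OF that(1)] aut[OF that(2)] that
    by (auto simp: hom_def AutoGroup_def BijGroup_def auto_def compose_def)
  have one: "\<phi> \<one>\<^bsub>K\<^esub> a = a" if "a \<in> carrier A" for a
  proof -
    have "\<phi> \<one>\<^bsub>K\<^esub> (\<phi> \<one>\<^bsub>K\<^esub> a) = \<phi> \<one>\<^bsub>K\<^esub> a"
      using act[of "\<one>\<^bsub>K\<^esub>" "\<one>\<^bsub>K\<^esub>" a] that by simp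
    moreover have "inj_on (\<phi> \<one>\<^bsub>K\<^esub>) (carrier A)"
      using aut[of "\<one>\<^bsub>K\<^esub>"] by (auto simp: auto_def Bij_def bij_betw_def)
    ultimately show ?thesis
      using that cl by (meson K.one_closed inj_onD)
  qed
  show ?thesis
  proof (rule groupI)
    fix x assume "x \<in> carrier (semidirect_product A K \<phi>)"
    then obtain a k where x: "x = (a, k)" "a \<in> carrier A" "k \<in> carrier K"
      by (auto simp: semidirect_product_def)
    let ?y = "(\<phi> (inv\<^bsub>K\<^esub> k) (inv\<^bsub>A\<^esub> a), inv\<^bsub>K\<^esub> k)"
    have "\<phi> (inv\<^bsub>K\<^esub> k) (inv\<^bsub>A\<^esub> a) \<otimes>\<^bsub>A\<^esub> \<phi> (inv\<^bsub>K\<^esub> k) a = \<one>\<^bsub>A\<^esub>"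
      using mul[of "inv\<^bsub>K\<^esub> k" "inv\<^bsub>A\<^esub> a" a] mul[of "inv\<^bsub>K\<^esub> k" "\<one>\<^bsub>A\<^esub>" "\<one>\<^bsub>A\<^esub>"]
        x cl[of "inv\<^bsub>K\<^esub> k" "\<one>\<^bsub>A\<^esub>"] by (simp add: A.r_cancel_one')
    then show "\<exists>y\<in>carrier (semidirect_product A K \<phi>).
        y \<otimes>\<^bsub>semidirect_product A K \<phi>\<^esub> x = \<one>\<^bsub>semidirect_product A K \<phi>\<^esub>"
      using x cl by (intro bexI[of _ ?y]) (auto simp: semidirect_product_def)
  qed (auto simp: semidirect_product_def cl mul act one A.m_assoc K.m_assoc)
qed

context group
begin

lemma trivial_in_abelian_subgroups: "{\<one>} \<in> abelian_subgroups G"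
proof -
  have "subgroup {\<one>} G" by (rule triv_subgroup)
  moreover from this have "comm_group (G\<lparr>carrier := {\<one>}\<rparr>)"
    by (intro group.group_comm_groupI subgroup_imp_group) auto
  ultimately show ?thesis by (simp add: abelian_subgroups_def)
qed

lemma abelian_subgroups_comm:
  assumes "H \<in> abelian_subgroups G" "x \<in> H" "y \<in> H"
  shows "x \<otimes> y = y \<otimes> x"
  using assms comm_groupE(4)[of "G\<lparr>carrier := H\<rparr>" x y] by (auto simp: abelian_subgroups_def)

lemma generate_in_abelian_subgroups:
  assumes S: "S \<subseteq> carrier G" and c: "\<And>x y. x \<in> S \<Longrightarrow> y \<in> S \<Longrightarrow> x \<otimes> y = y \<otimes> x"
  shows "generate G S \<in> abelian_subgroups G"
proof -
  have sub: "subgroup {g \<in> carrier G. \<forall>t\<in>T. g \<otimes> t = t \<otimes> g} G"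
    if T: "T \<subseteq> carrier G" for T
  proof (rule subgroupI)
    fix g assume g: "g \<in> {g \<in> carrier G. \<forall>t\<in>T. g \<otimes> t = t \<otimes> g}"
    have "inv g \<otimes> t = t \<otimes> inv g" if "t \<in> T" for t
    proof -
      have t: "t \<in> carrier G" using that T by blast
      have gG: "g \<in> carrier G" using g by simp
      have "inv g \<otimes> t = inv g \<otimes> (t \<otimes> g) \<otimes> inv g"
        using gG t by (simp add: m_assoc)
      also have "\<dots> = inv g \<otimes> (g \<otimes> t) \<otimes> inv g" using g that by simp
      also have "\<dots> = t \<otimes> inv g" using gG t by (simp add: m_assoc[symmetric])
      finally show ?thesis .
    qed
    then show "inv g \<in> {g \<in> carrier G. \<forall>t\<in>T. g \<otimes> t = t \<otimes> g}" using g by auto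
  next
    fix g h
    assume g: "g \<in> {g \<in> carrier G. \<forall>t\<in>T. g \<otimes> t = t \<otimes> g}"
      and h: "h \<in> {g \<in> carrier G. \<forall>t\<in>T. g \<otimes> t = t \<otimes> g}"
    have "g \<otimes> h \<otimes> t = t \<otimes> (g \<otimes> h)" if "t \<in> T" for t
    proof -
      have t: "t \<in> carrier G" using that T by blast
      have "g \<otimes> h \<otimes> t = g \<otimes> (t \<otimes> h)" using g h t that by (simp add: m_assoc)
      also have "\<dots> = g \<otimes> t \<otimes> h" using g h t by (simp add: m_assoc)
      also have "\<dots> = t \<otimes> g \<otimes> h" using g that by simp
      finally show ?thesis using g h t by (simp add: m_assoc)
    qed
    then show "g \<otimes> h \<in> {g \<in> carrier G. \<forall>t\<in>T. g \<otimes> t = t \<otimes> g}" using g h by auto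
  next
    have "\<one> \<in> {g \<in> carrier G. \<forall>t\<in>T. g \<otimes> t = t \<otimes> g}" using T by auto
    then show "{g \<in> carrier G. \<forall>t\<in>T. g \<otimes> t = t \<otimes> g} \<noteq> {}" by blast
  qed auto
  have gc: "generate G S \<subseteq> carrier G" using S generate_incl by blast
  have "generate G S \<subseteq> {g \<in> carrier G. \<forall>t\<in>S. g \<otimes> t = t \<otimes> g}"
    using S c by (intro generate_subgroup_incl[OF _ sub[OF S]]) auto
  then have "generate G S \<subseteq> {g \<in> carrier G. \<forall>t\<in>generate G S. g \<otimes> t = t \<otimes> g}"
    using S by (intro generate_subgroup_incl[OF _ sub[OF gc]]) (auto simp: subset_iff)
  moreover have "subgroup (generate G S) G" by (rule generate_is_subgroup[OF S])
  moreover from this have "group (G\<lparr>carrier := generate G S\<rparr>)" by (rule subgroup_imp_group)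
  ultimately show ?thesis
    unfolding abelian_subgroups_def by (auto intro!: group.group_comm_groupI)
qed

end

locale finite_group = group +
  assumes fin: "finite (carrier G)"
begin

lemma order_pos: "order G > 0"
  using fin by (simp add: order_gt_0_iff_finite)

lemma finite_abelian_subgroups: "finite (abelian_subgroups G)"
  using fin by (rule_tac finite_subset[of _ "Pow (carrier G)"])
    (auto simp: abelian_subgroups_def dest: subgroup.subset)

lemma max_abelian_order_obtain:
  obtains M where "M \<in> abelian_subgroups G" "card M = max_abelian_order G"
proof -
  have "max_abelian_order G \<in> card ` abelian_subgroups G"
    unfolding max_abelian_order_def
    using finite_abelian_subgroups trivial_in_abelian_subgroups by (intro Max_in) auto
  then show ?thesis using that by auto
qed

lemma card_le_max_abelian_order:
  "H \<in> abelian_subgroups G \<Longrightarrow> card H \<le> max_abelian_order G"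
  unfolding max_abelian_order_def using finite_abelian_subgroups by (intro Max_ge) auto

lemma finite_commuting_tuples: "finite (commuting_tuples G r)"
  by (rule finite_subset[OF _ finite_lists_length_eq[OF fin, of r]])
    (auto simp: commuting_tuples_def)

lemma card_commuting_tuples_ge: "max_abelian_order G ^ r \<le> card (commuting_tuples G r)"
proof -
  obtain M where M: "M \<in> abelian_subgroups G" "card M = max_abelian_order G"
    by (rule max_abelian_order_obtain)
  have MG: "M \<subseteq> carrier G"
    using M(1) by (auto simp: abelian_subgroups_def dest: subgroup.subset)
  have "{xs. set xs \<subseteq> M \<and> length xs = r} \<subseteq> commuting_tuples G r"
    using MG abelian_subgroups_comm[OF M(1)] by (auto simp: commuting_tuples_def)
  from card_mono[OF finite_commuting_tuples this] show ?thesis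
    using M(2) card_lists_length_eq[OF finite_subset[OF MG fin], of r] by simp
qed

lemma card_commuting_tuples_le:
  "card (commuting_tuples G r) \<le> card (abelian_subgroups G) * max_abelian_order G ^ r"
proof -
  let ?L = "\<lambda>B. {xs. set xs \<subseteq> B \<and> length xs = r}"
  have finB: "finite B" if "B \<in> abelian_subgroups G" for B
    using that fin by (auto simp: abelian_subgroups_def dest: subgroup.subset finite_subset)
  have "commuting_tuples G r \<subseteq> (\<Union>B\<in>abelian_subgroups G. ?L B)"
  proof
    fix xs assume "xs \<in> commuting_tuples G r"
    then have "generate G (set xs) \<in> abelian_subgroups G" "length xs = r"
      by (auto simp: commuting_tuples_def intro: generate_in_abelian_subgroups)
    moreover have "set xs \<subseteq> generate G (set xs)" by (auto intro: generate.incl)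
    ultimately show "xs \<in> (\<Union>B\<in>abelian_subgroups G. ?L B)" by blast
  qed
  then have "card (commuting_tuples G r) \<le> card (\<Union>B\<in>abelian_subgroups G. ?L B)"
    using finite_abelian_subgroups finB by (intro card_mono) (auto intro: finite_lists_length_eq)
  also have "\<dots> \<le> (\<Sum>B\<in>abelian_subgroups G. card (?L B))"
    using finite_abelian_subgroups by (rule card_UN_le)
  also have "\<dots> \<le> (\<Sum>B\<in>abelian_subgroups G. max_abelian_order G ^ r)"
    using finB card_le_max_abelian_order
    by (intro sum_mono) (simp add: card_lists_length_eq power_mono)
  finally show ?thesis by simp
qed

lemma commuting_orbits_le: "commuting_orbits G r \<le> card (commuting_tuples G r)"
proof -
  have "orbits G (commuting_tuples G r) (diag_conj G)
      = orbit G (diag_conj G) ` commuting_tuples G r"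
    by (auto simp: orbits_def)
  then show ?thesis
    unfolding commuting_orbits_def using finite_commuting_tuples by (simp add: card_image_le)
qed

lemma commuting_tuples_le_orbits:
  "card (commuting_tuples G r) \<le> order G * commuting_orbits G r"
proof -
  let ?O = "orbits G (commuting_tuples G r) (diag_conj G)"
  have O: "?O = orbit G (diag_conj G) ` commuting_tuples G r"
    by (auto simp: orbits_def)
  have im: "orbit G (diag_conj G) xs = (\<lambda>g. diag_conj G g xs) ` carrier G" for xs
    by (auto simp: orbit_def)
  have finO: "finite ?O" using O finite_commuting_tuples by simp
  have "xs \<in> orbit G (diag_conj G) xs" if "xs \<in> commuting_tuples G r" for xs
  proof -
    have "diag_conj G \<one> xs = xs"
      using that by (auto simp: diag_conj_def commuting_tuples_def subset_iff intro!: map_idI)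
    then show ?thesis by (force simp: im)
  qed
  then have "commuting_tuples G r \<subseteq> \<Union>?O" using O by auto
  then have "card (commuting_tuples G r) \<le> card (\<Union>?O)"
    using finO O im fin by (intro card_mono) auto
  also have "\<dots> \<le> (\<Sum>X\<in>?O. card X)"
    using card_UN_le[OF finO, of "\<lambda>X. X"] by simp
  also have "\<dots> \<le> (\<Sum>X\<in>?O. order G)"
    using O im fin by (intro sum_mono) (auto simp: order_def card_image_le)
  finally show ?thesis by (simp add: commuting_orbits_def mult.commute)
qed

lemma root_growth:
  fixes f :: "nat \<Rightarrow> real"
  assumes c: "0 < c" and C: "0 < C" and m: "0 \<le> m"
    and lo: "\<And>r. c * m ^ r \<le> f r" and hi: "\<And>r. f r \<le> C * m ^ r"
  shows "(\<lambda>r. root r (f r)) \<longlonglongrightarrow> m"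
proof (rule tendsto_sandwich)
  show "\<forall>\<^sub>F r in sequentially. root r c * m \<le> root r (f r)"
    using eventually_gt_at_top[of 0]
  proof eventually_elim
    case (elim r)
    then show ?case
      using real_root_le_mono[OF elim lo[of r]] m by (simp add: real_root_mult real_root_power_cancel)
  qed
  show "\<forall>\<^sub>F r in sequentially. root r (f r) \<le> root r C * m"
    using eventually_gt_at_top[of 0]
  proof eventually_elim
    case (elim r)
    then show ?case
      using real_root_le_mono[OF elim hi[of r]] m by (simp add: real_root_mult real_root_power_cancel)
  qed
  show "(\<lambda>r. root r c * m) \<longlonglongrightarrow> m" "(\<lambda>r. root r C * m) \<longlonglongrightarrow> m"
    using tendsto_mult[OF LIMSEQ_root_const[OF c] tendsto_const[of m]]
      tendsto_mult[OF LIMSEQ_root_const[OF C] tendsto_const[of m]] by simp_all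
qed

lemma abelian_subgroups_card_pos: "0 < card (abelian_subgroups G)"
  using finite_abelian_subgroups trivial_in_abelian_subgroups by (auto simp: card_gt_0_iff)

lemma tendsto_lambda_prob:
  "(\<lambda>r. root r (commuting_prob G r)) \<longlonglongrightarrow> real (max_abelian_order G) / real (order G)"
proof (rule root_growth[where c = 1 and C = "real (card (abelian_subgroups G))"])
  fix r
  have "real (max_abelian_order G) ^ r \<le> real (card (commuting_tuples G r))"
    using card_commuting_tuples_ge[of r] by (metis of_nat_le_iff of_nat_power)
  then show "1 * (real (max_abelian_order G) / real (order G)) ^ r \<le> commuting_prob G r"
    using order_pos by (simp add: commuting_prob_def power_divide divide_right_mono)
  have "real (card (commuting_tuples G r))
      \<le> real (card (abelian_subgroups G)) * real (max_abelian_order G) ^ r"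
    using card_commuting_tuples_le[of r] by (metis of_nat_le_iff of_nat_mult of_nat_power)
  from divide_right_mono[OF this, of "real (order G) ^ r"]
  show "commuting_prob G r
      \<le> real (card (abelian_subgroups G)) * (real (max_abelian_order G) / real (order G)) ^ r"
    by (simp add: commuting_prob_def power_divide)
qed (use abelian_subgroups_card_pos in auto)

lemma tendsto_lambda_orb:
  "(\<lambda>r. root r (real (commuting_orbits G r))) \<longlonglongrightarrow> real (max_abelian_order G)"
proof (rule root_growth[where c = "1 / real (order G)"
        and C = "real (card (abelian_subgroups G))"])
  fix r
  have "max_abelian_order G ^ r \<le> order G * commuting_orbits G r"
    using card_commuting_tuples_ge[of r] commuting_tuples_le_orbits[of r] by linarith
  then have "real (max_abelian_order G) ^ r \<le> real (order G) * real (commuting_orbits G r)"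
    by (metis of_nat_le_iff of_nat_mult of_nat_power)
  then show "1 / real (order G) * real (max_abelian_order G) ^ r \<le> real (commuting_orbits G r)"
    using order_pos by (simp add: field_simps)
  have "commuting_orbits G r \<le> card (abelian_subgroups G) * max_abelian_order G ^ r"
    using card_commuting_tuples_le[of r] commuting_orbits_le[of r] by linarith
  then show "real (commuting_orbits G r)
      \<le> real (card (abelian_subgroups G)) * real (max_abelian_order G) ^ r"
    by (metis of_nat_le_iff of_nat_mult of_nat_power)
qed (use abelian_subgroups_card_pos order_pos in auto)

end

text \<open>\<^const>\<open>lim\<close> is unspecified on divergent sequences; the following two facts show that
  \<^const>\<open>lambda_prob\<close> and \<^const>\<open>lambda_orb\<close> are genuine limits for finite groups.\<close>

lemma convergent_lambda_prob:
  assumes "group G" "finite (carrier G)"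
  shows "convergent (\<lambda>r. root r (commuting_prob G r))"
  using finite_group.tendsto_lambda_prob[of G] assms
  by (auto simp: finite_group_def finite_group_axioms_def convergent_def)

lemma convergent_lambda_orb:
  assumes "group G" "finite (carrier G)"
  shows "convergent (\<lambda>r. root r (real (commuting_orbits G r)))"
  using finite_group.tendsto_lambda_orb[of G] assms
  by (auto simp: finite_group_def finite_group_axioms_def convergent_def)

end

theory Submission
  imports Defs
begin

text \<open>If \<open>H \<le> A \<rtimes> K\<close> is abelian with projection \<open>B\<close> to \<open>K\<close>, two elements of \<open>H\<close> in the same
  fibre over \<open>B\<close> differ by an element of \<open>H \<inter> A\<close>. Since \<open>A\<close> is abelian, commuting with \<open>H\<close> forces
  \<open>H \<inter> A \<le> C\<^sub>A(B)\<close>, whence \<open>|H| \<le> |C\<^sub>A(B)| |B|\<close>. Conversely the elements of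
  \<open>C\<^sub>A(B) \<times> B\<close> commute pairwise whenever \<open>B\<close> is abelian. The growth rates only depend
  on the maximal order of an abelian subgroup.\<close>

text \<open>Used with \<open>h = snd\<close>: the projection to \<open>K\<close> of an abelian
  subgroup of the semidirect product is one of the subgroups over which the maximum is
  taken.\<close>

lemma (in group) abelian_subgroups_image:
  assumes "group L" "h \<in> hom G L" "H \<in> abelian_subgroups G"
  shows "h ` H \<in> abelian_subgroups L"
proof -
  interpret L: group L by fact
  interpret h: group_hom G L h
    by unfold_locales fact
  have H: "subgroup H G" using assms(3) by (simp add: abelian_subgroups_def)
  have HG: "H \<subseteq> carrier G" using H by (rule subgroup.subset)
  have sub: "subgroup (h ` H) L" using H by (rule h.subgroup_img_is_subgroup)
  have "h x \<otimes>\<^bsub>L\<^esub> h y = h y \<otimes>\<^bsub>L\<^esub> h x" if "x \<in> H" "y \<in> H" for x y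
    using that HG abelian_subgroups_comm[OF assms(3) that] by (metis h.hom_mult subsetD)
  then have "comm_group (L\<lparr>carrier := h ` H\<rparr>)"
    using sub by (auto intro!: group.group_comm_groupI L.subgroup_imp_group)
  then show ?thesis using sub by (simp add: abelian_subgroups_def)
qed

locale semidirect_action = A: comm_group A + K: group K
  for A :: "('a, 'm) monoid_scheme" (structure) and K :: "('k, 'n) monoid_scheme"
    and \<phi> :: "'k \<Rightarrow> 'a \<Rightarrow> 'a" +
  assumes action_hom: "\<phi> \<in> hom K (AutoGroup A)"
begin

abbreviation G where "G \<equiv> semidirect_product A K \<phi>"

sublocale G: group G
  using A.group_axioms K.group_axioms action_hom by (rule group_semidirect_product)

lemma carrier_semidirect: "carrier G = carrier A \<times> carrier K"
  by (simp add: semidirect_product_def)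

lemma mult_semidirect: "(a, k) \<otimes>\<^bsub>G\<^esub> (b, l) = (a \<otimes> \<phi> k b, k \<otimes>\<^bsub>K\<^esub> l)"
  by (simp add: semidirect_product_def)

lemma action_auto: "k \<in> carrier K \<Longrightarrow> \<phi> k \<in> auto A"
  using action_hom by (auto simp: hom_def AutoGroup_def)

lemma action_closed: "k \<in> carrier K \<Longrightarrow> a \<in> carrier A \<Longrightarrow> \<phi> k a \<in> carrier A"
  using action_auto[of k] by (auto simp: auto_def hom_def)

lemma action_mult:
  "k \<in> carrier K \<Longrightarrow> a \<in> carrier A \<Longrightarrow> b \<in> carrier A \<Longrightarrow> \<phi> k (a \<otimes> b) = \<phi> k a \<otimes> \<phi> k b"
  using action_auto[of k] by (auto simp: auto_def hom_def)

lemma abelian_subgroup_subset: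
  "H \<in> abelian_subgroups G \<Longrightarrow> H \<subseteq> carrier A \<times> carrier K"
  using subgroup.subset[of H G] by (simp add: abelian_subgroups_def carrier_semidirect)

lemma snd_hom: "snd \<in> hom G K"
  by (auto simp: hom_def carrier_semidirect mult_semidirect)

text \<open>Elements of \<open>B\<close> act trivially on first coordinates taken from
  \<open>fixed_by A \<phi> B\<close>, so products of such pairs are componentwise and commute. A
  lower bound on cardinality only needs some abelian subgroup containing the product set, and the
  generated one spares a closure check.\<close>

lemma fixed_product_in_abelian_subgroup:
  assumes B: "B \<in> abelian_subgroups K"
  obtains H where "H \<in> abelian_subgroups G" "fixed_by A \<phi> B \<times> B \<subseteq> H"
proof
  have BK: "B \<subseteq> carrier K"
    using B by (auto simp: abelian_subgroups_def dest: subgroup.subset)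
  show "generate G (fixed_by A \<phi> B \<times> B) \<in> abelian_subgroups G"
  proof (rule G.generate_in_abelian_subgroups)
    show "fixed_by A \<phi> B \<times> B \<subseteq> carrier G"
      using BK by (auto simp: carrier_semidirect fixed_by_def)
    show "x \<otimes>\<^bsub>G\<^esub> y = y \<otimes>\<^bsub>G\<^esub> x"
      if "x \<in> fixed_by A \<phi> B \<times> B" "y \<in> fixed_by A \<phi> B \<times> B" for x y
      using that K.abelian_subgroups_comm[OF B]
      by (auto simp: mult_semidirect fixed_by_def A.m_comm)
  qed
qed (auto intro: generate.incl)

text \<open>Both \<open>(a, k)\<close> and \<open>(c, k)\<close> commute with any
  \<open>(d, l)\<close> in \<open>H\<close>. Dividing the two resulting identities in the abelian
  group \<open>A\<close> cancels \<open>d\<close> and the common factor \<open>\<phi> k d\<close>,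
  which leaves the invariance of the quotient under \<open>l\<close>.\<close>

lemma fibre_quotient_fixed:
  assumes H: "H \<in> abelian_subgroups G" and ak: "(a, k) \<in> H" and ck: "(c, k) \<in> H"
  shows "a \<otimes> inv c \<in> fixed_by A \<phi> (snd ` H)"
proof -
  have HG: "H \<subseteq> carrier A \<times> carrier K"
    using H by (rule abelian_subgroup_subset)
  have a: "a \<in> carrier A" and c: "c \<in> carrier A" and k: "k \<in> carrier K"
    using HG ak ck by auto
  have "\<phi> l (a \<otimes> inv c) = a \<otimes> inv c" if dl: "(d, l) \<in> H" for d l
  proof -
    define x where "x = a \<otimes> inv c"
    have d: "d \<in> carrier A" and l: "l \<in> carrier K" using HG dl by auto
    have x: "x \<in> carrier A" and a_eq: "a = x \<otimes> c"
      using a c by (simp_all add: x_def A.m_assoc)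
    note cl = x c d action_closed[OF k d] action_closed[OF l c] action_closed[OF l x]
    have e1: "a \<otimes> \<phi> k d = d \<otimes> \<phi> l a" and e2: "c \<otimes> \<phi> k d = d \<otimes> \<phi> l c"
      using G.abelian_subgroups_comm[OF H ak dl] G.abelian_subgroups_comm[OF H ck dl]
      by (simp_all add: mult_semidirect)
    \<comment> \<open>The chain turns \<open>x\<close> into \<open>\<phi> l x\<close> in front of
      the same factor \<open>d \<otimes> \<phi> l c\<close>, which is then cancelled on the
      right.\<close>
    have "x \<otimes> (d \<otimes> \<phi> l c) = x \<otimes> (c \<otimes> \<phi> k d)" by (simp add: e2)
    also have "\<dots> = a \<otimes> \<phi> k d" using cl by (simp add: a_eq A.m_assoc)
    also have "\<dots> = d \<otimes> (\<phi> l x \<otimes> \<phi> l c)" using e1 l x c by (simp add: a_eq action_mult)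
    also have "\<dots> = \<phi> l x \<otimes> (d \<otimes> \<phi> l c)" using cl by (simp add: A.m_lcomm)
    finally show ?thesis using cl by (simp add: x_def)
  qed
  then show ?thesis using a c by (auto simp: fixed_by_def)
qed

lemma card_abelian_subgroup_le:
  assumes fin: "finite (carrier A)" "finite (carrier K)" and H: "H \<in> abelian_subgroups G"
  shows "card H \<le> card (fixed_by A \<phi> (snd ` H)) * card (snd ` H)"
proof -
  let ?B = "snd ` H" and ?C = "fixed_by A \<phi> (snd ` H)"
  have HG: "H \<subseteq> carrier A \<times> carrier K"
    using H by (rule abelian_subgroup_subset)
  \<comment> \<open>A section of the projection from \<open>H\<close>: one base point in each
    nonempty fibre. Translating \<open>?C\<close> by the base points covers all of
    \<open>H\<close>.\<close>
  define s where "s k = (SOME c. (c, k) \<in> H)" for k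
  have s: "(s k, k) \<in> H" if "(a, k) \<in> H" for a k
    unfolding s_def using that by (rule someI)
  have "H \<subseteq> (\<lambda>(x, k). (x \<otimes> s k, k)) ` (?C \<times> ?B)"
  proof clarify
    fix a k assume ak: "(a, k) \<in> H"
    have "a \<in> carrier A" "s k \<in> carrier A" using HG ak s[OF ak] by auto
    then have "a = (a \<otimes> inv (s k)) \<otimes> s k" by (simp add: A.m_assoc)
    moreover have "a \<otimes> inv (s k) \<in> ?C" by (rule fibre_quotient_fixed[OF H ak s[OF ak]])
    moreover have "k \<in> ?B" using ak by force
    ultimately show "(a, k) \<in> (\<lambda>(x, k). (x \<otimes> s k, k)) ` (?C \<times> ?B)"
      by (intro image_eqI[of _ _ "(a \<otimes> inv (s k), k)"]) auto
  qed
  moreover have "finite (?C \<times> ?B)"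
    using fin finite_subset[OF HG] by (simp add: fixed_by_def)
  ultimately have "card H \<le> card (?C \<times> ?B)" by (rule surj_card_le[rotated])
  then show ?thesis by (simp add: card_cartesian_product)
qed

theorem max_abelian_order_semidirect:
  assumes fin: "finite (carrier A)" "finite (carrier K)"
  shows "max_abelian_order G =
    Max {card (fixed_by A \<phi> B) * card B | B. B \<in> abelian_subgroups K}"
proof -
  interpret GF: finite_group G
    using fin by unfold_locales (simp add: carrier_semidirect)
  interpret KF: finite_group K using fin by unfold_locales
  let ?f = "\<lambda>B. card (fixed_by A \<phi> B) * card B"
  obtain H where H: "H \<in> abelian_subgroups G" "card H = max_abelian_order G"
    by (rule GF.max_abelian_order_obtain)
  have B: "snd ` H \<in> abelian_subgroups K"
    by (rule G.abelian_subgroups_image[OF K.group_axioms snd_hom H(1)])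
  have upper: "?f B \<le> max_abelian_order G" if B: "B \<in> abelian_subgroups K" for B
  proof -
    obtain L where L: "L \<in> abelian_subgroups G" "fixed_by A \<phi> B \<times> B \<subseteq> L"
      using fixed_product_in_abelian_subgroup[OF B] .
    have "finite L"
      using L(1) GF.fin by (auto simp: abelian_subgroups_def dest: subgroup.subset finite_subset)
    then have "?f B \<le> card L"
      using card_mono[OF _ L(2)] by (simp add: card_cartesian_product)
    also have "\<dots> \<le> max_abelian_order G" by (rule GF.card_le_max_abelian_order[OF L(1)])
    finally show ?thesis .
  qed
  have "max_abelian_order G = ?f (snd ` H)"
    using upper[OF B] card_abelian_subgroup_le[OF fin H(1)] H(2) by simp
  then have "max_abelian_order G = Max (?f ` abelian_subgroups K)"
    using B upper KF.finite_abelian_subgroups by (intro Max_eqI[symmetric]) auto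
  then show ?thesis by (simp add: Setcompr_eq_image)
qed

end

theorem proposition4p3:
  fixes A :: "('a, 'm) monoid_scheme" and K :: "('k, 'n) monoid_scheme"
    and \<phi> :: "'k \<Rightarrow> 'a \<Rightarrow> 'a"
  assumes "comm_group A" and "group K"
    and "finite (carrier A)" and "finite (carrier K)"
    and "\<phi> \<in> hom K (AutoGroup A)"
  shows "let G = semidirect_product A K \<phi>;
             M = Max {card (fixed_by A \<phi> B) * card B | B. B \<in> abelian_subgroups K}
         in max_abelian_order G = M
          \<and> lambda_prob G = 1 / (real (order A) * real (order K)) * real M
          \<and> lambda_orb G = real M
          \<and> h_prob G = ln (real (order A) * real (order K) / real M)
          \<and> h_orb G = ln (real M)"
proof -
  let ?G = "semidirect_product A K \<phi>"
  let ?M = "Max {card (fixed_by A \<phi> B) * card B | B. B \<in> abelian_subgroups K}"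
  interpret semidirect_action A K \<phi>
    using assms by (simp add: semidirect_action_def semidirect_action_axioms_def)
  interpret GF: finite_group ?G
    using assms(3,4) by unfold_locales (simp add: carrier_semidirect)
  have M: "max_abelian_order ?G = ?M"
    using assms(3,4) by (rule max_abelian_order_semidirect)
  have ord: "order ?G = order A * order K"
    by (simp add: order_def carrier_semidirect card_cartesian_product)
  \<comment> \<open>The commuting r-tuples number between m(G)^r and a constant times m(G)^r, and
    passing to orbits divides by at most |G|. Such constants vanish under r-th roots.\<close>
  have prob: "lambda_prob ?G = real ?M / (real (order A) * real (order K))"
    using limI[OF GF.tendsto_lambda_prob] by (simp add: lambda_prob_def M ord)
  have orb: "lambda_orb ?G = real ?M"
    using limI[OF GF.tendsto_lambda_orb] by (simp add: lambda_orb_def M)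
  \<comment> \<open>The trivial subgroup has order 1. Positivity makes \<open>lambda_prob\<close>
    positive, so the minus sign moves inside \<open>ln\<close> as a reciprocal.\<close>
  have "0 < ?M"
    using GF.card_le_max_abelian_order[OF G.trivial_in_abelian_subgroups] M by simp
  moreover have "0 < order A * order K" using GF.order_pos ord by simp
  ultimately have "h_prob ?G = ln (real (order A) * real (order K) / real ?M)"
    unfolding h_prob_def prob by (subst ln_inverse[symmetric]) (auto simp: inverse_eq_divide)
  then show ?thesis using M prob orb by (simp add: Let_def h_orb_def)
qed

end
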